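(* Let $f\colon\mathbb{R}^n\to[-\infty,+\infty]$ be a proper nearly convex function, $\Omega_0\subset\mathbb{R}^n$ a nonempty nearly convex set, and $g_1,\dots,g_m\colon\mathbb{R}^n\to[-\infty,+\infty]$ proper nearly convex functions. Let $\Omega_1=\{x\in\mathbb{R}^n\mid g_i(x)\le0,\ i=1,\dots,m\}$ and $D=\Omega_0\cap\Omega_1$. Assume that there is a point $x^0\in(\mathrm{ri}\,\Omega_0)\cap\bigl(\bigcap_{i=1}^m\mathrm{ri}(\mathrm{dom}\,g_i)\bigr)$ with $g_i(x^0)<0$ for all $i=1,\dots,m$ and with $x^0\in\mathrm{ri}(\mathrm{dom}\,f)$. Let $\bar x\in\bar D$ be a point at which the functions $\bar g_1,\dots,\bar g_m$ are continuous. Then $\bar x$ is a solution of the associated convex optimization problem $\min\{\bar f(x)\mid x\in\bar D\}$ if and only if there exist Lagrange multipliers $\lambda_1\ge0,\dots,\lambda_m\ge0$ such that $$0\in\partial\bar f(\bar x)+\sum_{i=1}^m\lambda_i\,\partial\bar g_i(\bar x)+N(\bar x;\overline{\Omega_0})$$ and $\lambda_i\bar g_i(\bar x)=0$ for $i=1,\dots,m$.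
   Context: A set $\Omega\subset\mathbb{R}^n$ is nearly convex if there is a convex set $C\subset\mathbb{R}^n$ with $C\subset\Omega\subset\bar C$, where the bar on a set denotes topological closure. For an arbitrary set $\Omega$, $\mathrm{ri}\,\Omega$ is the interior of $\Omega$ relative to its affine hull. For $h\colon\mathbb{R}^n\to[-\infty,+\infty]$: $\mathrm{dom}\,h=\{x\mid h(x)<+\infty\}$, $\mathrm{epi}\,h=\{(x,\lambda)\in\mathbb{R}^n\times\mathbb{R}\mid h(x)\le\lambda\}$; $h$ is proper if $\mathrm{dom}\,h\ne\emptyset$ and $h(x)>-\infty$ for all $x$; $h$ is nearly convex if $\mathrm{epi}\,h$ is a nearly convex set. For any function $h$, $\bar h(x)=\inf\{\alpha\in\mathbb{R}\mid (x,\alpha)\in\overline{\mathrm{epi}\,h}\}$, with $\inf\emptyset=+\infty$. $h$ is continuous at $\bar x$ if $\bar x\in\mathrm{int}(\mathrm{dom}\,h)$ and for every $\varepsilon>0$ there is $\delta>0$ such that the open ball $B(\bar x,\delta)\subset\mathrm{dom}\,h$ and $|h(x)-h(\bar x)|<\varepsilon$ for all $x\in B(\bar x,\delta)$. If $h(\bar x)\in\mathbb{R}$, $\partial h(\bar x)=\{x^*\in\mathbb{R}^n\mid\langle x^*,x-\bar x\rangle\le h(x)-h(\bar x)\ \text{for all }x\in\mathbb{R}^n\}$; set $\partial h(\bar x)=\emptyset$ if $h(\bar x)\notin\mathbb{R}$. The normal cone to a nearly convex set $\Omega$ at $\bar x\in\Omega$ is $N(\bar x;\Omega)=\{x^*\in\mathbb{R}^n\mid\langle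 x^*,x-\bar x\rangle\le0\ \text{for all }x\in\Omega\}$. A solution of a problem $\min\{h(x)\mid x\in E\}$ is a point $\bar x\in E$ with $h(\bar x)\le h(x)$ for all $x\in E$. *)

theory Defs
  imports "HOL-Analysis.Analysis"
begin

definition nearly_convex :: "'a::euclidean_space set \<Rightarrow> bool" where
  "nearly_convex S \<longleftrightarrow> (\<exists>C. convex C \<and> C \<subseteq> S \<and> S \<subseteq> closure C)"

definition eff_dom :: "('a::euclidean_space \<Rightarrow> ereal) \<Rightarrow> 'a set" where
  "eff_dom h = {x. h x < \<infinity>}"

definition epi :: "('a::euclidean_space \<Rightarrow> ereal) \<Rightarrow> ('a \<times> real) set" where
  "epi h = {(x, r). h x \<le> ereal r}"

definition proper_fun :: "('a::euclidean_space \<Rightarrow> ereal) \<Rightarrow> bool" where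
  "proper_fun h \<longleftrightarrow> eff_dom h \<noteq> {} \<and> (\<forall>x. h x > -\<infinity>)"

definition nearly_convex_fun :: "('a::euclidean_space \<Rightarrow> ereal) \<Rightarrow> bool" where
  "nearly_convex_fun h \<longleftrightarrow> nearly_convex (epi h)"

text \<open>The closure of \<open>h\<close>. The infimum is taken in \<^typ>\<open>ereal\<close>, so it is \<open>\<infinity>\<close> when
  no \<open>(x, \<alpha>)\<close> lies in the closed epigraph.\<close>

definition fun_closure :: "('a::euclidean_space \<Rightarrow> ereal) \<Rightarrow> 'a \<Rightarrow> ereal" where
  "fun_closure h x = Inf {ereal \<alpha> | \<alpha>. (x, \<alpha>) \<in> closure (epi h)}"

text \<open>In \<^typ>\<open>ereal\<close> a difference of two equal infinite values is \<open>\<infinity>\<close>, so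
  the condition at \<open>x = x0\<close> already forces \<open>h x0\<close> to be finite.\<close>

definition continuous_at_pt :: "('a::euclidean_space \<Rightarrow> ereal) \<Rightarrow> 'a \<Rightarrow> bool" where
  "continuous_at_pt h x0 \<longleftrightarrow>
     x0 \<in> interior (eff_dom h) \<and>
     (\<forall>\<epsilon>>0::real. \<exists>\<delta>>0. ball x0 \<delta> \<subseteq> eff_dom h \<and>
        (\<forall>x\<in>ball x0 \<delta>. \<bar>h x - h x0\<bar> < ereal \<epsilon>))"

definition subdifferential :: "('a::euclidean_space \<Rightarrow> ereal) \<Rightarrow> 'a \<Rightarrow> 'a set" where
  "subdifferential h x0 =
     (if \<bar>h x0\<bar> \<noteq> \<infinity> then {v. \<forall>x. ereal (v \<bullet> (x - x0)) \<le> h x - h x0} else {})"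

definition normal_cone :: "'a::euclidean_space \<Rightarrow> 'a set \<Rightarrow> 'a set" where
  "normal_cone x0 S = {v. \<forall>x\<in>S. v \<bullet> (x - x0) \<le> 0}"

definition is_solution :: "('a::euclidean_space \<Rightarrow> ereal) \<Rightarrow> 'a set \<Rightarrow> 'a \<Rightarrow> bool" where
  "is_solution h E x0 \<longleftrightarrow> x0 \<in> E \<and> (\<forall>x\<in>E. h x0 \<le> h x)"

end

theory Submission
  imports Defs
begin

text \<open>
  The epigraph of \<^term>\<open>fun_closure h\<close> is the closed convex set \<^term>\<open>closure (epi h)\<close>, and by
  the Slater condition \<^term>\<open>closure D\<close> is cut out of \<^term>\<open>closure \<Omega>0\<close> by the
  inequalities \<^term>\<open>fun_closure (g i) x \<le> 0\<close>, so the problem becomes a closed convex one.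
  Optimality of \<open>xbar\<close> says that \<open>(0, -1)\<close> is normal to the intersection of the epigraph of
  the objective with the cylinder over \<^term>\<open>closure D\<close>. This normal splits by the rule
  \<open>N(A \<inter> B) = N(A) + N(B)\<close> for convex sets with intersecting relative interiors. Since the
  constraints are continuous at \<open>xbar\<close>, the midpoint of \<open>x0\<close> and \<open>xbar\<close> is
  a common relative interior point for all the intersections involved.
\<close>

section \<open>Relative interiors of convex and nearly convex sets\<close>

lemma rel_interior_convex_combination:
  fixes S :: "'a::euclidean_space set"
  assumes "convex S" "a \<in> rel_interior S" "b \<in> closure S" "0 \<le> t" "t < 1"
  shows "(1 - t) *\<^sub>R a + t *\<^sub>R b \<in> rel_interior S"
proof (cases "t = 0 \<or> a = b")
  case True
  then show ?thesis
    using assms by (auto simp flip: scaleR_left_distrib)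
next
  case False
  then have "(1 - t) *\<^sub>R a + t *\<^sub>R b \<in> open_segment a b"
    using assms by (auto simp: in_segment intro!: exI[of _ t])
  then show ?thesis
    using rel_interior_closure_convex_segment assms by blast
qed

lemma interior_midpoint:
  fixes S :: "'a::euclidean_space set"
  assumes "convex S" "a \<in> interior S" "b \<in> closure S"
  shows "midpoint a b \<in> interior S"
proof (cases "a = b")
  case False
  then show ?thesis
    using in_interior_closure_convex_segment[OF assms] midpoint_in_open_segment by blast
qed (use assms in simp)

lemma rel_interior_midpoint:
  fixes S :: "'a::euclidean_space set"
  assumes "convex S" "a \<in> rel_interior S" "b \<in> closure S"
  shows "midpoint a b \<in> rel_interior S"
  using rel_interior_convex_combination[OF assms, of "1/2"]
  by (simp add: midpoint_def scaleR_right_distrib inverse_eq_divide)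

lemma midpoint_Pair: "midpoint (a, r) (b, s) = (midpoint a b, midpoint r s)"
  by (simp add: midpoint_def)

lemma mem_normal_cone: "v \<in> normal_cone x S \<longleftrightarrow> (\<forall>y\<in>S. v \<bullet> (y - x) \<le> 0)"
  by (simp add: normal_cone_def)

text \<open>From \<open>C \<subseteq> S \<subseteq> closure C\<close> the closures, hence the affine
  hulls, agree. So \<open>rel_interior S\<close> is squeezed between the relative interiors of
  \<open>C\<close> and of \<open>closure C\<close>, which coincide for convex
  \<open>C\<close>.\<close>

lemma nearly_convex_E:
  assumes "nearly_convex S"
  obtains C where "convex C" "C \<subseteq> S" "closure S = closure C" "rel_interior S = rel_interior C"
proof -
  obtain C where C: "convex C" "C \<subseteq> S" "S \<subseteq> closure C"
    using assms by (auto simp: nearly_convex_def)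
  have cl: "closure S = closure C"
    using C by (meson closed_closure closure_minimal closure_mono subset_antisym)
  then have aff: "affine hull S = affine hull C"
    by (metis closure_same_affine_hull)
  have "rel_interior C \<subseteq> rel_interior S"
    using C aff by (intro rel_interior_mono) auto
  moreover have "rel_interior S \<subseteq> rel_interior (closure C)"
    using C aff by (intro rel_interior_mono) auto
  ultimately show ?thesis
    using that[OF C(1,2) cl] convex_rel_interior_closure[OF C(1)] by simp
qed

section \<open>Separation and normal cones of intersections\<close>

text \<open>A supporting hyperplane serves if \<open>x\<close> lies in the closure, strict
  separation otherwise. The strict inequality is what later excludes vertical hyperplanes.\<close>

lemma separating_hyperplane_rel_interior:
  fixes S :: "'a::euclidean_space set"
  assumes "convex S" "x \<notin> rel_interior S"
  obtains a where "\<And>y. y \<in> S \<Longrightarrow> a \<bullet> x \<le> a \<bullet> y"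
    and "\<And>y. y \<in> rel_interior S \<Longrightarrow> a \<bullet> x < a \<bullet> y"
proof (cases "x \<in> closure S")
  case True
  then obtain a where "\<And>y. y \<in> closure S \<Longrightarrow> a \<bullet> x \<le> a \<bullet> y"
    "\<And>y. y \<in> rel_interior S \<Longrightarrow> a \<bullet> x < a \<bullet> y"
    using supporting_hyperplane_relative_frontier[OF assms(1) _ assms(2)] by metis
  then show ?thesis
    using that closure_subset[of S] by (meson subsetD)
next
  case False
  obtain a b where ab: "a \<bullet> x < b" "\<forall>y\<in>closure S. a \<bullet> y > b"
    using separating_hyperplane_closed_point[of "closure S" x] assms False by auto
  then have "a \<bullet> x < a \<bullet> y" if "y \<in> S" for y
    using that closure_subset[of S] by fastforce
  then show ?thesis
    using that rel_interior_subset[of S] by (meson less_imp_le subsetD)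
qed

text \<open>Separate \<open>0\<close> from the convex set of all \<open>(a - b, n \<bullet> (a - x) - s)\<close> with
  \<open>a \<in> A\<close>, \<open>b \<in> B\<close>, \<open>s \<ge> 0\<close>; the qualification condition rules out a vertical
  hyperplane.\<close>

lemma normal_cone_Int_subset:
  fixes A B :: "'a::euclidean_space set"
  assumes A: "convex A" and B: "convex B" and x: "x \<in> A" "x \<in> B"
    and z: "z \<in> rel_interior A" "z \<in> rel_interior B"
  shows "normal_cone x (A \<inter> B) \<subseteq> normal_cone x A + normal_cone x B"
proof
  fix n assume n: "n \<in> normal_cone x (A \<inter> B)"
  \<comment> \<open>Omitting the shift by \<open>n \<bullet> x\<close> keeps \<open>L\<close>
    linear; the point to separate is then \<open>(0, n \<bullet> x)\<close> instead of the
    origin.\<close>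
  define L where "L = (\<lambda>(a::'a, b::'a, s::real). (a - b, n \<bullet> a - s))"
  define T where "T = A \<times> B \<times> {0::real..}"
  have lin: "linear L"
    by (rule linearI) (auto simp: L_def inner_right_distrib algebra_simps)
  have T: "convex T"
    unfolding T_def using A B by (intro convex_Times) auto
  have riT: "rel_interior T = rel_interior A \<times> rel_interior B \<times> {0<..}"
    unfolding T_def using A B by (simp add: rel_interior_Times convex_Times)
  have riL: "rel_interior (L ` T) = L ` (rel_interior A \<times> rel_interior B \<times> {0<..})"
    using rel_interior_convex_linear_image[OF lin T] riT by simp
  have "(0, n \<bullet> x) \<notin> rel_interior (L ` T)"
  proof
    assume "(0, n \<bullet> x) \<in> rel_interior (L ` T)"
    then obtain a b s where "a \<in> rel_interior A" "b \<in> rel_interior B" "s > 0"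
      "L (a, b, s) = (0, n \<bullet> x)"
      unfolding riL by (elim imageE SigmaE) (simp add: greaterThan_def)
    then have "a \<in> rel_interior A" "b \<in> rel_interior B" "s > 0"
      "a - b = 0" "n \<bullet> a - s = n \<bullet> x"
      unfolding L_def by auto
    moreover from this have "a \<in> A \<inter> B"
      using rel_interior_subset by (metis IntI eq_iff_diff_eq_0 subsetD)
    then have "n \<bullet> (a - x) \<le> 0"
      using n by (simp add: mem_normal_cone)
    ultimately show False
      by (simp add: inner_diff_right)
  qed
  then obtain c where c: "\<And>y. y \<in> L ` T \<Longrightarrow> c \<bullet> (0, n \<bullet> x) \<le> c \<bullet> y"
    "\<And>y. y \<in> rel_interior (L ` T) \<Longrightarrow> c \<bullet> (0, n \<bullet> x) < c \<bullet> y"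
    using separating_hyperplane_rel_interior convex_linear_image[OF lin T] by blast
  obtain w \<gamma> where w: "c = (w, \<gamma>)"
    by force
  have sep: "\<gamma> * (n \<bullet> x) \<le> w \<bullet> (a - b) + \<gamma> * (n \<bullet> a - s)"
    if "a \<in> A" "b \<in> B" "s \<ge> 0" for a b s
  proof -
    have "L (a, b, s) \<in> L ` T"
      using that by (simp add: T_def)
    from c(1)[OF this] show ?thesis
      by (simp add: w L_def)
  qed
  \<comment> \<open>At the image of \<open>(z, z, 1)\<close> the \<open>w\<close> part cancels, so
    strictness leaves a nonzero \<open>\<gamma>\<close>.\<close>
  have "\<gamma> * (n \<bullet> x) < \<gamma> * (n \<bullet> z - 1)"
    using c(2)[of "L (z, z, 1)"] z unfolding riL by (force simp: w L_def)
  then have "\<gamma> \<noteq> 0"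
    by auto
  moreover have "\<gamma> \<le> 0"
    using sep[OF x, of 1] by (simp add: algebra_simps)
  ultimately have neg: "\<gamma> < 0"
    by simp
  define u where "u = (1 / - \<gamma>) *\<^sub>R w"
  have sep': "n \<bullet> (a - x) \<le> u \<bullet> (a - b)" if "a \<in> A" "b \<in> B" for a b
    using sep[OF that, of 0] neg by (simp add: u_def field_simps inner_diff_right)
  have "n - u \<in> normal_cone x A"
    using sep'[OF _ x(2)] by (simp add: mem_normal_cone inner_diff_left)
  moreover have "u \<in> normal_cone x B"
    using sep'[OF x(1)] by (simp add: mem_normal_cone inner_diff_right)
  ultimately have "(n - u) + u \<in> normal_cone x A + normal_cone x B"
    by (rule set_plus_intro)
  then show "n \<in> normal_cone x A + normal_cone x B"
    by simp
qed

text \<open>Iterates the two-set rule. \<open>K\<close> is arbitrary in the induction so that it can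
  absorb \<open>E j\<close>; \<open>z\<close> stays in the relative interior of
  \<open>K \<inter> E j\<close>.\<close>

lemma normal_cone_Int_INT:
  fixes K :: "'a::euclidean_space set" and E :: "'i \<Rightarrow> 'a set"
  assumes "finite I" "convex K" "x \<in> K" "z \<in> rel_interior K"
    and "\<And>i. i \<in> I \<Longrightarrow> convex (E i)" "\<And>i. i \<in> I \<Longrightarrow> x \<in> E i"
    and "\<And>i. i \<in> I \<Longrightarrow> z \<in> rel_interior (E i)"
    and "n \<in> normal_cone x (K \<inter> (\<Inter>i\<in>I. E i))"
  shows "\<exists>q. n - sum q I \<in> normal_cone x K \<and> (\<forall>i\<in>I. q i \<in> normal_cone x (E i))"
  using assms
proof (induction I arbitrary: K rule: finite_induct)
  case empty
  then show ?case
    by auto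
next
  case (insert j I)
  let ?K = "K \<inter> E j"
  have "rel_interior ?K = rel_interior K \<inter> rel_interior (E j)"
    using insert.prems by (intro convex_rel_interior_inter_two) auto
  moreover have "?K \<inter> (\<Inter>i\<in>I. E i) = K \<inter> (\<Inter>i\<in>insert j I. E i)"
    by auto
  ultimately obtain q where q: "n - sum q I \<in> normal_cone x ?K"
      "\<forall>i\<in>I. q i \<in> normal_cone x (E i)"
    using insert.IH[of ?K] insert.prems by (auto simp: convex_Int)
  have "normal_cone x ?K \<subseteq> normal_cone x K + normal_cone x (E j)"
    using insert.prems by (intro normal_cone_Int_subset[where z = z]) auto
  then obtain a b where ab: "a \<in> normal_cone x K" "b \<in> normal_cone x (E j)"
      "n - sum q I = a + b"
    using q(1) by (meson set_plus_elim subsetD)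
  have "sum (q(j := b)) (insert j I) = b + sum q I"
    using insert.hyps by (auto intro!: sum.cong)
  then have "n - sum (q(j := b)) (insert j I) = a"
    using ab(3) by (simp add: algebra_simps)
  then show ?case
    using ab q(2) by (intro exI[of _ "q(j := b)"]) auto
qed

section \<open>Subgradients as normals to the epigraph\<close>

lemma mem_epi: "(x, r) \<in> epi h \<longleftrightarrow> h x \<le> ereal r"
  by (simp add: epi_def)

lemma epi_nonvertical_normal_imp_subgradient:
  fixes h :: "'a::euclidean_space \<Rightarrow> ereal"
  assumes "h x = ereal c" "c' > 0" "(v, - c') \<in> normal_cone (x, c) (epi h)"
  shows "(1 / c') *\<^sub>R v \<in> subdifferential h x"
proof -
  have *: "v \<bullet> (y - x) \<le> c' * (r - c)" if "h y \<le> ereal r" for y r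
  proof -
    have "(v, - c') \<bullet> ((y, r) - (x, c)) \<le> 0"
      using assms(3) that unfolding mem_normal_cone by (meson mem_epi)
    then show ?thesis
      by simp
  qed
  have "ereal (((1 / c') *\<^sub>R v) \<bullet> (y - x)) \<le> h y - ereal c" for y
  proof (cases "h y")
    case (real r)
    then show ?thesis
      using *[of y r] assms(2) by (simp add: field_simps)
  next
    case MInf
    \<comment> \<open>If \<open>h y\<close> were \<open>-\<infinity>\<close>, every height would be
      allowed; the height \<open>k / c' - 1 + c\<close> makes the right-hand side
      \<open>k - c'\<close>, too small.\<close>
    define k where "k = v \<bullet> (y - x)"
    have "k \<le> c' * (k / c' - 1)"
      using *[of y "k / c' - 1 + c"] MInf by (simp add: k_def)
    then have "c' \<le> 0"
      using assms(2) by (simp add: right_diff_distrib)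
    then show ?thesis
      using assms(2) by simp
  qed simp
  then show ?thesis
    using assms(1) by (simp add: subdifferential_def)
qed

lemma subgradient_imp_epi_normal:
  assumes "v \<in> subdifferential h x" "h x = ereal c" "h y \<le> ereal r"
  shows "v \<bullet> (y - x) \<le> r - c"
proof -
  have "ereal (v \<bullet> (y - x)) \<le> h y - ereal c"
    using assms by (simp add: subdifferential_def)
  also have "\<dots> \<le> ereal r - ereal c"
    using assms(3) by (rule ereal_minus_mono) simp
  finally show ?thesis
    by simp
qed

section \<open>Closed epigraphs and relative interiors of epigraphs\<close>

text \<open>An upward translation maps the epigraph into itself, hence also its closure.\<close>

lemma mem_closure_epi_mono:
  assumes "(x, r) \<in> closure (epi h)" "r \<le> s"
  shows "(x, s) \<in> closure (epi h)"
proof -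
  have "(+) (0, s - r) ` epi h \<subseteq> epi h"
  proof (rule image_subsetI)
    fix p assume p: "p \<in> epi h"
    obtain y t where yt: "p = (y, t)"
      by force
    have "h y \<le> ereal t" "ereal t \<le> ereal (s - r + t)"
      using assms(2) p by (simp_all add: mem_epi yt)
    then have "h y \<le> ereal (s - r + t)"
      by (rule order_trans)
    then show "(0, s - r) + p \<in> epi h"
      by (simp add: mem_epi yt)
  qed
  then have "(+) (0, s - r) ` closure (epi h) \<subseteq> closure (epi h)"
    by (metis closure_mono closure_translation)
  moreover have "(x, s) = (0, s - r) + (x, r)"
    by simp
  ultimately show ?thesis
    using assms(1) by blast
qed

text \<open>The infimum is attained when finite: each vertical slice of the closed epigraph is
  closed and upward closed, so the heights \<open>r + 1 / (n + 1)\<close> can be passed to the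
  limit.\<close>

lemma fun_closure_le_iff: "fun_closure h x \<le> ereal r \<longleftrightarrow> (x, r) \<in> closure (epi h)"
proof
  assume le: "fun_closure h x \<le> ereal r"
  have above: "(x, s) \<in> closure (epi h)" if "r < s" for s
  proof -
    have "fun_closure h x < ereal s"
      using le that by (simp add: order_le_less_trans)
    then obtain \<alpha> where "(x, \<alpha>) \<in> closure (epi h)" "\<alpha> < s"
      unfolding fun_closure_def Inf_less_iff by auto
    then show ?thesis
      using mem_closure_epi_mono less_imp_le by metis
  qed
  let ?s = "\<lambda>n. (x, r + inverse (real (Suc n)))"
  have lim: "?s \<longlonglongrightarrow> (x, r + 0)"
    by (intro tendsto_Pair tendsto_add tendsto_const LIMSEQ_inverse_real_of_nat)
  have "?s n \<in> closure (epi h)" for n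
    by (intro above) simp
  then have "(x, r + 0) \<in> closure (epi h)"
    using closed_sequentially[OF closed_closure _ lim] by blast
  then show "(x, r) \<in> closure (epi h)"
    by simp
qed (auto simp: fun_closure_def intro: Inf_lower)

lemma epi_fun_closure: "epi (fun_closure h) = closure (epi h)"
  by (auto simp: mem_epi fun_closure_le_iff)

lemma fun_closure_le: "fun_closure h x \<le> h x"
proof (rule ereal_le_real)
  fix r assume "h x \<le> ereal r"
  then have "(x, r) \<in> closure (epi h)"
    using closure_subset mem_epi by blast
  then show "fun_closure h x \<le> ereal r"
    by (simp add: fun_closure_le_iff)
qed

lemma nearly_convex_closure:
  assumes "nearly_convex S"
  shows "convex (closure S)" "rel_interior (closure S) = rel_interior S"
  using assms by (metis nearly_convex_E convex_closure convex_rel_interior_closure)+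

lemma fst_image_epi: "fst ` epi h = eff_dom h"
proof -
  have "\<exists>r. h x \<le> ereal r" if "h x < \<infinity>" for x
    using that by (cases "h x") auto
  then show ?thesis
    by (force simp: epi_def eff_dom_def image_iff)
qed

text \<open>A point of \<open>rel_interior (eff_dom h)\<close> lifts to some point \<open>(x, s)\<close> of
  the relative interior of the epigraph, and \<open>(x, r)\<close> lies on an open segment from it to a
  point of the epigraph on the same vertical line.\<close>

lemma mem_rel_interior_epi:
  assumes h: "nearly_convex_fun h" and x: "x \<in> rel_interior (eff_dom h)"
    and r: "h x < ereal r"
  shows "(x, r) \<in> rel_interior (epi h)"
proof -
  obtain C where C: "convex C" "C \<subseteq> epi h" "closure (epi h) = closure C"
      "rel_interior (epi h) = rel_interior C"
    using h unfolding nearly_convex_fun_def by (rule nearly_convex_E)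
  \<comment> \<open>The domain lies between the projection of \<open>C\<close> and its closure, so
    both have the same affine hull. Relative interior commutes with the linear projection of
    \<open>C\<close>, which lifts \<open>x\<close>.\<close>
  have "fst ` C \<subseteq> eff_dom h"
    using C(2) fst_image_epi by blast
  moreover have "eff_dom h \<subseteq> closure (fst ` C)"
  proof -
    have "eff_dom h \<subseteq> fst ` closure C"
      using C(3) closure_subset fst_image_epi by (metis image_mono)
    also have "\<dots> \<subseteq> closure (fst ` C)"
      by (rule closure_bounded_linear_image_subset[OF bounded_linear_fst])
    finally show ?thesis .
  qed
  moreover have "affine hull (fst ` C) = affine hull (eff_dom h)"
    using calculation by (metis closure_same_affine_hull hull_mono subset_antisym)
  ultimately have "rel_interior (eff_dom h) \<subseteq> rel_interior (closure (fst ` C))"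
    by (intro rel_interior_mono) auto
  also have "\<dots> = fst ` rel_interior C"
    using C(1) by (simp add: convex_rel_interior_closure convex_linear_image linear_fst
        rel_interior_convex_linear_image)
  finally obtain s where s: "(x, s) \<in> rel_interior C"
    using x by force
  obtain r' where r': "(x, r') \<in> closure C" "r' < r"
  proof -
    obtain r' where "h x < ereal r'" "r' < r"
      using r ereal_dense2 by (metis ereal_less_ereal_Ex less_ereal.simps(1))
    then have "(x, r') \<in> epi h"
      by (simp add: mem_epi)
    then show ?thesis
      using that \<open>r' < r\<close> C(3) closure_subset by blast
  qed
  \<comment> \<open>The far endpoint is chosen beyond \<open>r\<close> as seen from
    \<open>s\<close>: upwards if \<open>s \<le> r\<close>, downwards otherwise. This makes
    \<open>0 \<le> t < 1\<close>.\<close>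
  define r'' where "r'' = (if s \<le> r then r + 1 else r')"
  have "(x, r'') \<in> closure C"
    using mem_closure_epi_mono[of x r' h] r' C(3) by (simp add: r''_def)
  moreover define t where "t = (r - s) / (r'' - s)"
  have "r'' \<noteq> s"
    using r'(2) by (auto simp: r''_def)
  then have "t * (r'' - s) = r - s"
    by (simp add: t_def)
  then have "(1 - t) * s + t * r'' = r"
    by (simp add: algebra_simps)
  moreover have "0 \<le> t" "t < 1"
    using r'(2) by (auto simp: t_def r''_def field_simps)
  moreover have "(1 - t) *\<^sub>R x + t *\<^sub>R x = x"
    by (simp flip: scaleR_left_distrib)
  ultimately have "(x, r) \<in> rel_interior C"
    using rel_interior_convex_combination[OF C(1) s, of "(x, r'')" t] by simp
  then show ?thesis
    using C(4) by simp
qed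

section \<open>Interior points of epigraphs and normals to sublevel sets\<close>

lemma continuous_at_pt_imp_finite:
  assumes "continuous_at_pt h x"
  obtains c where "h x = ereal c"
proof -
  obtain \<delta> where "\<delta> > 0" "\<forall>y\<in>ball x \<delta>. \<bar>h y - h x\<bar> < ereal 1"
    using assms unfolding continuous_at_pt_def by (meson zero_less_one)
  then have "\<bar>h x - h x\<bar> < ereal 1"
    using centre_in_ball by blast
  then show ?thesis
    using that by (cases "h x") auto
qed

text \<open>Near \<open>x\<close> the function stays below a level strictly under \<open>s\<close>,
  so a ball times an upper ray is an open subset of the epigraph.\<close>

lemma continuous_at_pt_interior_epi:
  assumes "continuous_at_pt h x" "h x = ereal c" "c < s"
  shows "(x, s) \<in> interior (epi h)"
proof -
  define e where "e = (s - c) / 2"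
  have e: "e > 0" "c + e < s"
    using assms(3) by (auto simp: e_def field_simps)
  obtain \<delta> where \<delta>: "\<delta> > 0" "\<forall>y\<in>ball x \<delta>. \<bar>h y - ereal c\<bar> < ereal e"
    using assms(1,2) e(1) unfolding continuous_at_pt_def by metis
  have "h y \<le> ereal r" if "y \<in> ball x \<delta>" "c + e < r" for y r
  proof -
    have "\<bar>h y - ereal c\<bar> < ereal e"
      using \<delta>(2) that(1) by blast
    then show ?thesis
      using that(2) by (cases "h y") auto
  qed
  then have "ball x \<delta> \<times> {c + e<..} \<subseteq> epi h"
    by (auto simp: mem_epi)
  moreover have "open (ball x \<delta> \<times> {c + e<..})"
    by (simp add: open_Times)
  ultimately show ?thesis
    using e \<delta> by (intro interiorI[of "ball x \<delta> \<times> {c + e<..}"]) auto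
qed

text \<open>Moving \<open>p\<close> a little in direction \<open>v\<close> stays in \<open>S\<close>
  but would make the inner product positive.\<close>

lemma normal_eq_0_if_interior:
  fixes v :: "'a::euclidean_space"
  assumes "v \<in> normal_cone x S" "p \<in> interior S" "v \<bullet> (p - x) = 0"
  shows "v = 0"
proof (rule ccontr)
  assume v: "v \<noteq> 0"
  obtain e where e: "e > 0" "cball p e \<subseteq> S"
    using assms(2) mem_interior_cball by blast
  have "p + (e / norm v) *\<^sub>R v \<in> cball p e"
    using v e by (simp add: dist_norm)
  then have "v \<bullet> ((p - x) + (e / norm v) *\<^sub>R v) \<le> 0"
    using assms(1) e(2) unfolding mem_normal_cone by (metis add_diff_eq add.commute subsetD)
  then have "e / norm v * (v \<bullet> v) \<le> 0"
    using assms(3) by (simp add: inner_add_right)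
  moreover have "e / norm v * (v \<bullet> v) > 0"
    using v e by simp
  ultimately show False
    by simp
qed

text \<open>\<open>(0, - 1)\<close> is normal to the epigraph cut by the vertical line over
  \<open>x\<close>. Normals to the line have no vertical part, so the summand normal to the epigraph
  keeps the component \<open>- 1\<close> and yields a subgradient.\<close>

lemma subdifferential_nonempty:
  fixes h :: "'a::euclidean_space \<Rightarrow> ereal"
  assumes "convex (epi h)" "h x = ereal c" "(x, s) \<in> interior (epi h)"
  shows "subdifferential h x \<noteq> {}"
proof -
  let ?B = "{x} \<times> (UNIV :: real set)"
  have B: "convex ?B" "rel_interior ?B = ?B"
    by (auto simp: convex_Times rel_interior_Times)
  have "(0, - 1) \<in> normal_cone (x, c) (epi h \<inter> ?B)"
    using assms(2) by (auto simp: mem_normal_cone mem_epi)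
  moreover have "normal_cone (x, c) (epi h \<inter> ?B)
      \<subseteq> normal_cone (x, c) (epi h) + normal_cone (x, c) ?B"
    using assms B interior_subset_rel_interior
    by (intro normal_cone_Int_subset[where z = "(x, s)"]) (auto simp: mem_epi)
  ultimately obtain p q where pq: "p \<in> normal_cone (x, c) (epi h)" "q \<in> normal_cone (x, c) ?B"
      "(0, - 1) = p + q"
    by (meson set_plus_elim subsetD)
  have "snd q * r \<le> 0" for r
    using pq(2) by (cases q) (auto simp: mem_normal_cone dest!: spec[of _ "c + r"])
  from this[of 1] this[of "- 1"] have "snd q = 0"
    by simp
  then have "p = (fst p, - 1)"
    using pq(3) by (cases p; cases q) simp
  then have "fst p \<in> subdifferential h x"
    using epi_nonvertical_normal_imp_subgradient[of h x c 1 "fst p"] assms(2) pq(1) by simp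
  then show ?thesis
    by blast
qed

text \<open>Lift \<open>v\<close> to \<open>(v, 0)\<close>, normal to the epigraph cut by the
  half-space of heights \<open>\<le> 0\<close>; \<open>(z, s)\<close> is interior to both. The
  half-space contributes \<open>(0, \<mu>)\<close>, leaving \<open>(v, - \<mu>)\<close> normal to
  the epigraph.\<close>

lemma sublevel_normal_cone:
  fixes h :: "'a::euclidean_space \<Rightarrow> ereal"
  assumes h: "convex (epi h)" "h x = ereal c" "c \<le> 0"
    and x: "(x, r) \<in> interior (epi h)"
    and z: "(z, s) \<in> interior (epi h)" "s < 0"
    and v: "v \<in> normal_cone x {y. h y \<le> 0}"
  obtains \<mu> w where "\<mu> \<ge> 0" "w \<in> subdifferential h x" "v = \<mu> *\<^sub>R w" "\<mu> * c = 0"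
proof -
  let ?B = "(UNIV :: 'a set) \<times> {..0::real}"
  have B: "convex ?B" "interior ?B = UNIV \<times> {..<0}"
    by (auto simp: convex_Times interior_Times)
  have "(v, 0) \<in> normal_cone (x, 0) (epi h \<inter> ?B)"
    unfolding mem_normal_cone
  proof safe
    fix y :: 'a and t :: real
    assume "(y, t) \<in> epi h" "t \<le> 0"
    then have "h y \<le> ereal t" "ereal t \<le> 0"
      by (simp_all add: mem_epi)
    then have "h y \<le> 0"
      by (rule order_trans)
    then show "(v, 0) \<bullet> ((y, t) - (x, 0)) \<le> 0"
      using v by (simp add: mem_normal_cone)
  qed
  moreover have "normal_cone (x, 0) (epi h \<inter> ?B)
      \<subseteq> normal_cone (x, 0) (epi h) + normal_cone (x, 0) ?B"
    using h z B(1)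
    by (intro normal_cone_Int_subset[where z = "(z, s)"]
        subsetD[OF interior_subset_rel_interior]) (auto simp: mem_epi B(2))
  ultimately obtain p q where pq: "p \<in> normal_cone (x, 0) (epi h)" "q \<in> normal_cone (x, 0) ?B"
      "(v, 0) = p + q"
    by (meson set_plus_elim subsetD)
  obtain a \<mu> where q: "q = (a, \<mu>)"
    by force
  have qB: "a \<bullet> y + \<mu> * t \<le> 0" if "t \<le> 0" for y t
  proof -
    have "(a, \<mu>) \<bullet> ((x + y, t) - (x, 0)) \<le> 0"
      using pq(2) that unfolding q mem_normal_cone by blast
    then show ?thesis
      by simp
  qed
  have "a = 0"
    using qB[of 0 a] inner_ge_zero[of a]
    by (metis add.right_neutral antisym inner_eq_zero_iff mult_zero_right order_refl)
  have "\<mu> \<ge> 0"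
    using qB[of "- 1" 0] by simp
  have "p = (v, 0) - q"
    using pq(3) by (simp add: algebra_simps)
  then have p: "(v, - \<mu>) \<in> normal_cone (x, 0) (epi h)"
    using pq(1) q \<open>a = 0\<close> by simp
  \<comment> \<open>Testing this normal at \<open>(x, c)\<close> gives complementary slackness; for
    \<open>\<mu> \<noteq> 0\<close> it forces \<open>c = 0\<close>, so the base point is on the
    graph.\<close>
  have "(x, c) \<in> epi h"
    using h(2) by (simp add: mem_epi)
  then have "(v, - \<mu>) \<bullet> ((x, c) - (x, 0)) \<le> 0"
    using p unfolding mem_normal_cone by blast
  then have "0 \<le> \<mu> * c"
    by simp
  moreover have "\<mu> * c \<le> 0"
    using \<open>\<mu> \<ge> 0\<close> h(3) by (rule mult_nonneg_nonpos)
  ultimately have \<mu>c: "\<mu> * c = 0"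
    by (rule antisym[rotated])
  show ?thesis
  proof (cases "\<mu> = 0")
    case True
    \<comment> \<open>A horizontal normal is orthogonal to the vertical displacement to the interior
      point \<open>(x, r)\<close>, so it vanishes, and any subgradient can serve as
      \<open>w\<close>.\<close>
    then have "(v, 0 :: real) = 0"
      using p x by (intro normal_eq_0_if_interior[of _ "(x, 0)" "epi h" "(x, r)"]) auto
    then have "v = 0"
      by (simp add: prod_eq_iff)
    then show ?thesis
      using subdifferential_nonempty[OF h(1,2) x] that[of 0] by auto
  next
    case False
    then have "(1 / \<mu>) *\<^sub>R v \<in> subdifferential h x"
      using p \<mu>c h(2) \<open>\<mu> \<ge> 0\<close> by (intro epi_nonvertical_normal_imp_subgradient[of h x c]) auto
    then show ?thesis
      using that[of \<mu> "(1 / \<mu>) *\<^sub>R v"] False \<mu>c \<open>\<mu> \<ge> 0\<close> by simp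
  qed
qed

section \<open>Properness of the closure and the closed feasible set\<close>

text \<open>A value \<open>-\<infinity>\<close> at \<open>y\<close> puts the whole vertical line
  over \<open>y\<close> in the closed epigraph. Midpoints with a relative interior point over
  \<open>x\<close> then fill a vertical line in \<open>epi h\<close>, contradicting
  properness.\<close>

lemma fun_closure_gt_MInf:
  assumes h: "proper_fun h" "nearly_convex_fun h" and x: "x \<in> rel_interior (eff_dom h)"
  shows "fun_closure h y > -\<infinity>"
proof (rule ccontr)
  assume "\<not> fun_closure h y > -\<infinity>"
  then have y: "(y, s) \<in> closure (epi h)" for s
    by (simp flip: fun_closure_le_iff)
  have "h x < \<infinity>"
    using x rel_interior_subset by (auto simp: eff_dom_def)
  then obtain r where "h x < ereal r"
    using less_PInf_Ex_of_nat by auto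
  then have r: "(x, r) \<in> rel_interior (epi h)"
    using mem_rel_interior_epi h x by blast
  obtain C where C: "convex C" "C \<subseteq> epi h" "closure (epi h) = closure C"
      "rel_interior (epi h) = rel_interior C"
    using h(2) unfolding nearly_convex_fun_def by (rule nearly_convex_E)
  have "h (midpoint x y) \<le> ereal t" for t
  proof -
    \<comment> \<open>The height \<open>2 * t - r\<close> makes the midpoint have height
      \<open>t\<close>.\<close>
    have "midpoint (x, r) (y, 2 * t - r) \<in> rel_interior C"
      using rel_interior_midpoint[OF C(1)] r y C(3,4) by blast
    then have "(midpoint x y, t) \<in> epi h"
      using C(2) rel_interior_subset by (force simp: midpoint_Pair midpoint_def)
    then show ?thesis
      by (simp add: mem_epi)
  qed
  then have "h (midpoint x y) = -\<infinity>"
    by (rule ereal_bot)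
  then show False
    using h(1) by (auto simp: proper_fun_def dest: spec[of _ "midpoint x y"])
qed

text \<open>A point of the right-hand side becomes feasible when moved slightly towards the Slater
  point \<open>x0\<close>.\<close>

lemma closure_feasible_set:
  fixes g :: "'i \<Rightarrow> 'a::euclidean_space \<Rightarrow> ereal"
  assumes S: "nearly_convex S" "x0 \<in> rel_interior S"
    and g: "\<And>i. i \<in> I \<Longrightarrow> nearly_convex_fun (g i)"
      "\<And>i. i \<in> I \<Longrightarrow> x0 \<in> rel_interior (eff_dom (g i))" "\<And>i. i \<in> I \<Longrightarrow> g i x0 < 0"
  shows "closure (S \<inter> {x. \<forall>i\<in>I. g i x \<le> 0})
    = closure S \<inter> (\<Inter>i\<in>I. {x. fun_closure (g i) x \<le> 0})"
    (is "closure ?D = ?R")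
proof
  have "closed {x. fun_closure (g i) x \<le> 0}" for i
  proof -
    have "{x. fun_closure (g i) x \<le> 0} = (\<lambda>x. (x, 0)) -` closure (epi (g i))"
      using fun_closure_le_iff[of "g i" _ 0] by (auto simp: zero_ereal_def)
    moreover have "closed ((\<lambda>x. (x, 0 :: real)) -` closure (epi (g i)))"
      by (rule closed_vimage[OF closed_closure])
        (intro continuous_on_Pair continuous_on_id continuous_on_const)
    ultimately show ?thesis
      by simp
  qed
  then have "closed ?R"
    by (intro closed_Int closed_closure closed_INT ballI)
  moreover have "?D \<subseteq> ?R"
    using closure_subset[of S] order_trans[OF fun_closure_le] by blast
  ultimately show "closure ?D \<subseteq> ?R"
    by (rule closure_minimal[rotated])
next
  show "?R \<subseteq> closure ?D"
  proof
    fix x assume x: "x \<in> ?R"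
    \<comment> \<open>The weights \<open>n / (n + 1)\<close> tend to 1 but stay below it, so each
      point keeps a positive share of \<open>x0\<close>.\<close>
    let ?y = "\<lambda>n. (1 - real n / real (Suc n)) *\<^sub>R x0 + (real n / real (Suc n)) *\<^sub>R x"
    have "?y n \<in> ?D" for n
    proof -
      define t where "t = real n / real (Suc n)"
      have t: "0 \<le> t" "t < 1"
        by (auto simp: t_def field_simps)
      define y where "y = (1 - t) *\<^sub>R x0 + t *\<^sub>R x"
      obtain C where C: "convex C" "closure S = closure C" "rel_interior S = rel_interior C"
        using S(1) nearly_convex_E by metis
      have "y \<in> rel_interior S"
        using rel_interior_convex_combination[OF C(1), of x0 x t] S(2) x t C by (simp add: y_def)
      then have "y \<in> S"
        using rel_interior_subset by blast
      moreover have "g i y \<le> 0" if i: "i \<in> I" for i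
      proof -
        \<comment> \<open>The segment from \<open>(x0, r)\<close> to \<open>(x, 0)\<close> runs
          through the epigraph at heights \<open>(1 - t) * r \<le> 0\<close>.\<close>
        obtain r where r: "g i x0 < ereal r" "r < 0"
          using g(3)[OF i] ereal_dense2 by (metis ereal_less(1))
        then have r': "(x0, r) \<in> rel_interior (epi (g i))"
          using mem_rel_interior_epi g i by blast
        obtain C where C: "convex C" "closure (epi (g i)) = closure C"
            "rel_interior (epi (g i)) = rel_interior C"
          using g(1)[OF i] nearly_convex_E unfolding nearly_convex_fun_def by metis
        have "(x, 0) \<in> closure C"
          using x i C(2) fun_closure_le_iff[of "g i" x 0] by (auto simp: zero_ereal_def)
        then have "(y, (1 - t) * r) \<in> rel_interior (epi (g i))"
          using rel_interior_convex_combination[OF C(1), of "(x0, r)" "(x, 0)" t] r' t C(3)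
          by (simp add: y_def)
        then have "g i y \<le> ereal ((1 - t) * r)"
          using rel_interior_subset mem_epi by blast
        also have "\<dots> \<le> 0"
          using r(2) t by (simp add: mult_nonneg_nonpos)
        finally show ?thesis .
      qed
      ultimately show ?thesis
        by (simp add: y_def t_def)
    qed
    moreover have "?y \<longlonglongrightarrow> (1 - 1) *\<^sub>R x0 + 1 *\<^sub>R x"
      by (intro tendsto_add tendsto_scaleR tendsto_diff tendsto_const LIMSEQ_n_over_Suc_n)
    ultimately show "x \<in> closure ?D"
      unfolding closure_sequential by (intro exI[of _ ?y]) simp
  qed
qed

section \<open>Necessity and sufficiency of the multiplier conditions\<close>

text \<open>The cylinder part of the normal \<open>(0, - 1)\<close> is \<open>(n, 0)\<close>, so
  \<open>- n\<close> is a subgradient of \<open>h\<close>. Then \<open>n\<close> splits into a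
  normal to \<open>K\<close> and normals to the sublevel sets, each a multiple of a subgradient of
  its constraint.\<close>

lemma optimal_imp_multipliers:
  fixes h :: "'a::euclidean_space \<Rightarrow> ereal" and \<gamma> :: "'i \<Rightarrow> 'a \<Rightarrow> ereal"
  assumes h: "convex (epi h)" "h x = ereal c" "(x0, r) \<in> rel_interior (epi h)"
    and K: "convex K" "x0 \<in> rel_interior K" "x \<in> K"
    and I: "finite I"
    and \<gamma>: "\<And>i. i \<in> I \<Longrightarrow> convex (epi (\<gamma> i))" "\<And>i. i \<in> I \<Longrightarrow> continuous_at_pt (\<gamma> i) x"
      "\<And>i. i \<in> I \<Longrightarrow> \<gamma> i x0 < 0" "\<And>i. i \<in> I \<Longrightarrow> \<gamma> i x \<le> 0"
    and min: "\<And>y. y \<in> K \<inter> (\<Inter>i\<in>I. {x. \<gamma> i x \<le> 0}) \<Longrightarrow> h x \<le> h y"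
  shows "\<exists>\<mu> :: 'i \<Rightarrow> real. (\<forall>i\<in>I. \<mu> i \<ge> 0) \<and>
      0 \<in> subdifferential h x + (\<Sum>i\<in>I. (\<lambda>v. \<mu> i *\<^sub>R v) ` subdifferential (\<gamma> i) x)
          + normal_cone x K \<and>
      (\<forall>i\<in>I. ereal (\<mu> i) * \<gamma> i x = 0)"
proof -
  define E where "E i = {x. \<gamma> i x \<le> 0}" for i
  let ?D = "K \<inter> (\<Inter>i\<in>I. E i)"
  define z where "z = midpoint x0 x"
  have E: "convex (E i)" if "i \<in> I" for i
  proof -
    have "E i = fst ` (epi (\<gamma> i) \<inter> UNIV \<times> {0})"
      by (force simp: E_def mem_epi zero_ereal_def)
    then show ?thesis
      using \<gamma>(1)[OF that] by (auto intro!: convex_linear_image linear_fst convex_Int convex_Times)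
  qed
  have \<gamma>int: "\<exists>c s. \<gamma> i x = ereal c \<and> c \<le> 0 \<and> (x, c + 1) \<in> interior (epi (\<gamma> i)) \<and>
      (z, s) \<in> interior (epi (\<gamma> i)) \<and> s < 0" if i: "i \<in> I" for i
  proof -
    obtain c where c: "\<gamma> i x = ereal c"
      using continuous_at_pt_imp_finite \<gamma>(2)[OF i] by blast
    obtain r where r: "\<gamma> i x0 < ereal r" "r < 0"
      using \<gamma>(3)[OF i] ereal_dense2 by (metis ereal_less(1))
    have int: "(x, c + e) \<in> interior (epi (\<gamma> i))" if "e > 0" for e
      using continuous_at_pt_interior_epi[OF \<gamma>(2)[OF i] c] that by simp
    have "(x0, r) \<in> closure (epi (\<gamma> i))"
      using r closure_subset by (meson less_imp_le mem_epi subsetD)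
    \<comment> \<open>Raising \<open>x\<close> by only \<open>- r / 2\<close> above the graph keeps
      the midpoint's height, half of \<open>c + r / 2\<close>, negative.\<close>
    then have "midpoint (x, c - r / 2) (x0, r) \<in> interior (epi (\<gamma> i))"
      using interior_midpoint[OF \<gamma>(1)[OF i]] int[of "- r / 2"] r(2) by simp
    then have "(z, midpoint (c - r / 2) r) \<in> interior (epi (\<gamma> i))"
      by (simp add: midpoint_Pair z_def midpoint_sym)
    moreover have "c \<le> 0"
      using \<gamma>(4)[OF i] c by simp
    moreover from this have "midpoint (c - r / 2) r < 0"
      using r(2) by (simp add: midpoint_def)
    ultimately show ?thesis
      using c int[of 1] by auto
  qed
  have zE: "z \<in> rel_interior (E i)" if i: "i \<in> I" for i
  proof -
    obtain s where s: "(z, s) \<in> interior (epi (\<gamma> i))" "s < 0"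
      using \<gamma>int[OF i] by blast
    obtain A B where AB: "open A" "open B" "(z, s) \<in> A \<times> B" "A \<times> B \<subseteq> interior (epi (\<gamma> i))"
      using s(1) open_prod_elim[OF open_interior] by metis
    have "A \<subseteq> E i"
    proof
      fix y assume "y \<in> A"
      then have "(y, s) \<in> epi (\<gamma> i)"
        using AB interior_subset by blast
      then have "\<gamma> i y \<le> ereal s" "ereal s \<le> 0"
        using s(2) by (simp_all add: mem_epi)
      then show "y \<in> E i"
        unfolding E_def by (auto intro: order_trans)
    qed
    then have "z \<in> interior (E i)"
      using AB by (auto intro: interiorI)
    then show ?thesis
      using interior_subset_rel_interior by blast
  qed
  have zK: "z \<in> rel_interior K"
    using rel_interior_midpoint[OF K(1,2)] K(3) closure_subset by (auto simp: z_def)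
  have xE: "x \<in> E i" if "i \<in> I" for i
    using \<gamma>(4)[OF that] by (simp add: E_def)
  have D: "convex ?D" "x \<in> ?D" "z \<in> rel_interior ?D"
  proof -
    have fin: "finite (insert K (E ` I))"
      using I by simp
    have conv: "convex S" if "S \<in> insert K (E ` I)" for S
      using that K(1) E by auto
    have z: "z \<in> \<Inter> (rel_interior ` insert K (E ` I))"
      using zK zE by auto
    then have "\<Inter> (rel_interior ` insert K (E ` I)) \<noteq> {}"
      by blast
    then have "rel_interior (\<Inter> (insert K (E ` I))) = \<Inter> (rel_interior ` insert K (E ` I))"
      using conv fin by (intro convex_rel_interior_finite_Inter)
    then have "z \<in> rel_interior (\<Inter> (insert K (E ` I)))"
      using z by blast
    then show "z \<in> rel_interior ?D"
      by simp
    show "convex ?D"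
      using K(1) E by (intro convex_Int convex_INT) auto
    show "x \<in> ?D"
      using K(3) xE by auto
  qed
  let ?B = "?D \<times> (UNIV :: real set)"
  have B: "convex ?B" "rel_interior ?B = rel_interior ?D \<times> UNIV"
    using D(1) by (auto simp: convex_Times rel_interior_Times)
  have "(x, c) \<in> epi h"
    using h(2) by (simp add: mem_epi)
  then have "midpoint (x0, r) (x, c) \<in> rel_interior (epi h)"
    using rel_interior_midpoint[OF h(1,3)] closure_subset by blast
  then have zh: "(z, midpoint r c) \<in> rel_interior (epi h)"
    by (simp add: midpoint_Pair z_def)
  have "(0, - 1) \<in> normal_cone (x, c) (epi h \<inter> ?B)"
  proof -
    have "c \<le> t" if "h y \<le> ereal t" "y \<in> ?D" for y t
      using min[of y] that h(2) order_trans by (fastforce simp: E_def)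
    then show ?thesis
      by (auto simp: mem_normal_cone mem_epi)
  qed
  moreover have "normal_cone (x, c) (epi h \<inter> ?B)
      \<subseteq> normal_cone (x, c) (epi h) + normal_cone (x, c) ?B"
    using \<open>(x, c) \<in> epi h\<close> D zh B h(1)
    by (intro normal_cone_Int_subset[where z = "(z, midpoint r c)"]) auto
  ultimately obtain p q where pq: "p \<in> normal_cone (x, c) (epi h)" "q \<in> normal_cone (x, c) ?B"
      "(0, - 1) = p + q"
    by (meson set_plus_elim subsetD)
  obtain n \<beta> where q: "q = (n, \<beta>)"
    by force
  have qB: "n \<bullet> (y - x) + \<beta> * t \<le> 0" if "y \<in> ?D" for y t
  proof -
    have "(n, \<beta>) \<bullet> ((y, c + t) - (x, c)) \<le> 0"
      using pq(2) that unfolding q mem_normal_cone by blast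
    then show ?thesis
      by simp
  qed
  \<comment> \<open>The cylinder is unbounded both ways vertically, so its normals are
    horizontal.\<close>
  have "\<beta> = 0"
    using qB[OF D(2), of 1] qB[OF D(2), of "- 1"] by simp
  have "p = (0, - 1) - q"
    using pq(3) by (simp add: algebra_simps)
  then have "p = (- n, - 1)"
    using q \<open>\<beta> = 0\<close> by simp
  then have nh: "- n \<in> subdifferential h x"
    using epi_nonvertical_normal_imp_subgradient[of h x c 1 "- n"] h(2) pq(1) by simp
  have "n \<in> normal_cone x ?D"
    using qB[of _ 0] by (simp add: mem_normal_cone)
  then obtain u where u: "n - sum u I \<in> normal_cone x K" "\<forall>i\<in>I. u i \<in> normal_cone x (E i)"
    using normal_cone_Int_INT[OF I K(1,3) zK, of E n] E xE zE by blast
  have "\<exists>\<mu> w. \<mu> \<ge> 0 \<and> w \<in> subdifferential (\<gamma> i) x \<and> u i = \<mu> *\<^sub>R w \<and> ereal \<mu> * \<gamma> i x = 0"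
    if i: "i \<in> I" for i
  proof -
    obtain c s where c: "\<gamma> i x = ereal c" "c \<le> 0" "(x, c + 1) \<in> interior (epi (\<gamma> i))"
      "(z, s) \<in> interior (epi (\<gamma> i))" "s < 0"
      using \<gamma>int[OF i] by blast
    have "u i \<in> normal_cone x {y. \<gamma> i y \<le> 0}"
      using u(2) i by (simp add: E_def)
    from sublevel_normal_cone[OF \<gamma>(1)[OF i] c this] show ?thesis
      using c(1) by (metis times_ereal.simps(1) zero_ereal_def)
  qed
  then obtain \<mu> w where \<mu>: "\<And>i. i \<in> I \<Longrightarrow> \<mu> i \<ge> 0"
    "\<And>i. i \<in> I \<Longrightarrow> w i \<in> subdifferential (\<gamma> i) x" "\<And>i. i \<in> I \<Longrightarrow> u i = \<mu> i *\<^sub>R w i"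
    "\<And>i. i \<in> I \<Longrightarrow> ereal (\<mu> i) * \<gamma> i x = 0"
    by metis
  have "sum u I \<in> (\<Sum>i\<in>I. (\<lambda>v. \<mu> i *\<^sub>R v) ` subdifferential (\<gamma> i) x)"
    unfolding set_sum_alt[OF I] using \<mu>(2,3) by blast
  then have "- n + sum u I + (n - sum u I) \<in> subdifferential h x
      + (\<Sum>i\<in>I. (\<lambda>v. \<mu> i *\<^sub>R v) ` subdifferential (\<gamma> i) x) + normal_cone x K"
    using nh u(1) by (intro set_plus_intro)
  then show ?thesis
    using \<mu>(1,4) by (intro exI[of _ \<mu>]) simp
qed

text \<open>Pair the zero sum with \<open>y - x\<close>. The constraint terms are nonpositive by the
  subgradient inequality and slackness, the normal term by definition, so the subgradient of
  \<open>h\<close> gives a nonnegative product.\<close>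

lemma multipliers_imp_optimal:
  fixes h :: "'a::euclidean_space \<Rightarrow> ereal" and \<gamma> :: "'i \<Rightarrow> 'a \<Rightarrow> ereal"
  assumes I: "finite I" and \<mu>: "\<And>i. i \<in> I \<Longrightarrow> \<mu> i \<ge> 0"
    and zero: "0 \<in> subdifferential h x
      + (\<Sum>i\<in>I. (\<lambda>v. \<mu> i *\<^sub>R v) ` subdifferential (\<gamma> i) x) + normal_cone x K"
    and slack: "\<And>i. i \<in> I \<Longrightarrow> ereal (\<mu> i) * \<gamma> i x = 0"
    and y: "y \<in> K" "\<And>i. i \<in> I \<Longrightarrow> \<gamma> i y \<le> 0"
  shows "h x \<le> h y"
proof -
  obtain v s n where v: "v \<in> subdifferential h x"
    and s: "s \<in> (\<Sum>i\<in>I. (\<lambda>v. \<mu> i *\<^sub>R v) ` subdifferential (\<gamma> i) x)"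
    and n: "n \<in> normal_cone x K" and sum0: "0 = v + s + n"
    using zero by (elim set_plus_elim) simp
  obtain u where u: "s = sum u I" "\<And>i. i \<in> I \<Longrightarrow> u i \<in> (\<lambda>v. \<mu> i *\<^sub>R v) ` subdifferential (\<gamma> i) x"
    using s unfolding set_sum_alt[OF I] by blast
  have "u i \<bullet> (y - x) \<le> 0" if i: "i \<in> I" for i
  proof -
    obtain w where w: "w \<in> subdifferential (\<gamma> i) x" "u i = \<mu> i *\<^sub>R w"
      using u(2)[OF i] by blast
    then obtain c where c: "\<gamma> i x = ereal c"
      by (cases "\<gamma> i x") (auto simp: subdifferential_def)
    have "w \<bullet> (y - x) \<le> 0 - c"
      by (rule subgradient_imp_epi_normal[OF w(1) c]) (use y(2)[OF i] in \<open>simp add: zero_ereal_def\<close>)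
    then have "\<mu> i * (w \<bullet> (y - x)) \<le> \<mu> i * (0 - c)"
      using \<mu>[OF i] by (rule mult_left_mono)
    also have "\<dots> = 0"
      using slack[OF i] c by simp
    finally show ?thesis
      by (simp add: w(2))
  qed
  then have "s \<bullet> (y - x) \<le> 0"
    unfolding u(1) inner_sum_left by (rule sum_nonpos)
  moreover have "n \<bullet> (y - x) \<le> 0"
    using n y(1) by (simp add: mem_normal_cone)
  moreover have "v \<bullet> (y - x) + s \<bullet> (y - x) + n \<bullet> (y - x) = 0"
    using sum0 by (metis inner_add_left inner_zero_left)
  ultimately have "0 \<le> v \<bullet> (y - x)"
    by linarith
  also obtain c where c: "h x = ereal c"
    using v by (cases "h x") (auto simp: subdifferential_def)
  show ?thesis
  \<comment> \<open>Comparing real upper bounds of \<open>h y\<close> covers its infinite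
    values.\<close>
  proof (rule ereal_le_real)
    fix r assume "h y \<le> ereal r"
    then have "v \<bullet> (y - x) \<le> r - c"
      by (rule subgradient_imp_epi_normal[OF v c])
    then show "h x \<le> ereal r"
      using \<open>0 \<le> v \<bullet> (y - x)\<close> c by simp
  qed
qed

theorem theorem4p3:
  fixes f :: "real ^ 'n \<Rightarrow> ereal"
    and g :: "nat \<Rightarrow> real ^ 'n \<Rightarrow> ereal"
    and m :: nat
    and \<Omega>0 \<Omega>1 D :: "(real ^ 'n) set"
    and x0 xbar :: "real ^ 'n"
  assumes "proper_fun f" and "nearly_convex_fun f"
    and "\<Omega>0 \<noteq> {}" and "nearly_convex \<Omega>0"
    and "\<And>i. i \<in> {1..m} \<Longrightarrow> proper_fun (g i)"
    and "\<And>i. i \<in> {1..m} \<Longrightarrow> nearly_convex_fun (g i)"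
    and "\<Omega>1 = {x. \<forall>i\<in>{1..m}. g i x \<le> 0}"
    and "D = \<Omega>0 \<inter> \<Omega>1"
    and "x0 \<in> rel_interior \<Omega>0 \<inter> (\<Inter>i\<in>{1..m}. rel_interior (eff_dom (g i)))"
    and "\<And>i. i \<in> {1..m} \<Longrightarrow> g i x0 < 0"
    and "x0 \<in> rel_interior (eff_dom f)"
    and "xbar \<in> closure D"
    and "\<And>i. i \<in> {1..m} \<Longrightarrow> continuous_at_pt (fun_closure (g i)) xbar"
  shows "is_solution (fun_closure f) (closure D) xbar \<longleftrightarrow>
    (\<exists>\<mu> :: nat \<Rightarrow> real.
       (\<forall>i\<in>{1..m}. \<mu> i \<ge> 0) \<and>
       0 \<in> subdifferential (fun_closure f) xbar
           + (\<Sum>i=1..m. (\<lambda>v. \<mu> i *\<^sub>R v) ` subdifferential (fun_closure (g i)) xbar)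
           + normal_cone xbar (closure \<Omega>0) \<and>
       (\<forall>i\<in>{1..m}. ereal (\<mu> i) * fun_closure (g i) xbar = 0))"
    (is "?sol \<longleftrightarrow> ?kkt")
proof -
  have clD: "closure D = closure \<Omega>0 \<inter> (\<Inter>i\<in>{1..m}. {x. fun_closure (g i) x \<le> 0})"
    unfolding assms(7,8) using assms(4,6,9,10) by (intro closure_feasible_set[of _ x0]) auto
  show ?thesis
  proof
    assume sol: ?sol
    \<comment> \<open>Feasibility of \<open>x0\<close> bounds the optimal value above; with
      \<open>fun_closure_gt_MInf\<close> the value is real, as the subdifferential requires.\<close>
    have "x0 \<in> closure D"
      using assms(9,10) rel_interior_subset[of \<Omega>0] closure_subset[of D]
      unfolding assms(7,8) by (force intro: less_imp_le)
    then have "fun_closure f xbar \<le> fun_closure f x0"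
      using sol by (simp add: is_solution_def)
    also have "\<dots> \<le> f x0"
      by (rule fun_closure_le)
    also have "f x0 < \<infinity>"
      using assms(11) rel_interior_subset by (auto simp: eff_dom_def)
    finally have "fun_closure f xbar < \<infinity>" .
    moreover have "fun_closure f xbar > -\<infinity>"
      using fun_closure_gt_MInf assms(1,2,11) by blast
    ultimately obtain c where c: "fun_closure f xbar = ereal c"
      by (cases "fun_closure f xbar") auto
    obtain r where "f x0 < ereal r"
      using \<open>f x0 < \<infinity>\<close> less_PInf_Ex_of_nat by auto
    then have r: "(x0, r) \<in> rel_interior (epi (fun_closure f))"
      using mem_rel_interior_epi assms(2,11) nearly_convex_closure(2)
      unfolding epi_fun_closure nearly_convex_fun_def by blast
    have conv: "convex (epi (fun_closure h))" if "nearly_convex_fun h" for h :: "real ^ 'n \<Rightarrow> ereal"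
      using that nearly_convex_closure(1) by (simp add: epi_fun_closure nearly_convex_fun_def)
    show ?kkt
    proof (rule optimal_imp_multipliers[OF conv[OF assms(2)] c r, of "closure \<Omega>0" "{1..m}"])
      show "convex (closure \<Omega>0)" "x0 \<in> rel_interior (closure \<Omega>0)"
        using nearly_convex_closure[OF assms(4)] assms(9) by auto
      show "fun_closure (g i) x0 < 0" if "i \<in> {1..m}" for i
        using assms(10)[OF that] fun_closure_le order_le_less_trans by blast
      show "fun_closure f xbar \<le> fun_closure f y"
        if "y \<in> closure \<Omega>0 \<inter> (\<Inter>i\<in>{1..m}. {x. fun_closure (g i) x \<le> 0})" for y
        using sol that unfolding is_solution_def clD by blast
    qed (use assms(6,12,13) conv clD in auto)
  next
    assume ?kkt
    then obtain \<mu> :: "nat \<Rightarrow> real" where \<mu>: "\<forall>i\<in>{1..m}. \<mu> i \<ge> 0"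
       "0 \<in> subdifferential (fun_closure f) xbar
           + (\<Sum>i=1..m. (\<lambda>v. \<mu> i *\<^sub>R v) ` subdifferential (fun_closure (g i)) xbar)
           + normal_cone xbar (closure \<Omega>0)"
       "\<forall>i\<in>{1..m}. ereal (\<mu> i) * fun_closure (g i) xbar = 0"
      by blast
    have "fun_closure f xbar \<le> fun_closure f y" if "y \<in> closure D" for y
      using multipliers_imp_optimal[OF _ _ \<mu>(2), of y] \<mu>(1,3) that unfolding clD by simp
    then show ?sol
      using assms(12) by (simp add: is_solution_def)
  qed
qed

end
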